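(* Let $\varepsilon\in[0,\frac{616}{634})$ and let $S\in\mathbb{R}^{p\times n}$ be an $(\varepsilon,d,m)$ oblivious $\ell_2$-subspace embedding. Suppose $V\in\mathbb{R}^{n\times m}$ has full rank, $1<m\le p\le n$, $nm\mathbf{u}\le\frac1{12}$, $p^{3/2}\mathbf{u}\le\frac1{12}$, and $$\delta:=\frac{383\left(pm^{3/2}+\sqrt m\left(p^{3/2}\sqrt{1+\varepsilon}+n\|S\|_F\right)\right)}{\sqrt{1-\varepsilon}}\,\mathbf{u}\,\kappa(V)\le1 .$$ Let $\hat Q$ be the orthogonal factor computed in floating point arithmetic by $\texttt{rand\_cholQR}$ applied to $V$ with the single sketch $S$. Then, with probability at least $1-d$, $\kappa(\hat Q)\approx1$; in fact $$\kappa(\hat Q)<\sqrt{\frac{1+\frac{5445}{\left(25\sqrt{\frac{1-\varepsilon}{1+\varepsilon}}-3\right)^2}(nm+m(m+1))\mathbf{u}}{1-\frac{5445}{\left(25\sqrt{\frac{1-\varepsilon}{1+\varepsilon}}-3\right)^2}(nm+m(m+1))\mathbf{u}}}\;.$$ Furthermore, if $\frac{5445}{\left(25\sqrt{\frac{1-\varepsilon}{1+\varepsilon}}-3\right)^2}(nm+m(m+1))\mathbf{u}<\frac12$, then (with the same probability) $$\kappa(\hat Q)<1+\frac{10890}{\left(25\sqrt{\frac{1-\varepsilon}{1+\varepsilon}}-3\right)^2}(nm+m(m+1))\mathbf{u}.$$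
   Context: Embeddings. For $\varepsilon\in[0,1)$, a matrix $S\in\mathbb{R}^{p\times n}$ is an $\varepsilon$-subspace embedding for a subspace $\mathcal V\subset\mathbb{R}^n$ if $|\langle x,y\rangle-\langle Sx,Sy\rangle|\le\varepsilon\|x\|_2\|y\|_2$ for all $x,y\in\mathcal V$. A random $S\in\mathbb{R}^{p\times n}$ is an $(\varepsilon,d,m)$ oblivious $\ell_2$-subspace embedding if, for any fixed $m$-dimensional subspace $\mathcal V\subset\mathbb{R}^n$, it is an $\varepsilon$-subspace embedding for $\mathcal V$ with probability at least $1-d$. Probabilities are over the draw of $S$; $V$ is fixed. The norm of $S$ appearing in $\delta$ is that of the drawn matrix, for which $\delta\le1$ is assumed. Notation. $\sigma_1\ge\dots\ge\sigma_m$ are singular values, $\kappa(X)=\sigma_1(X)/\sigma_m(X)$ for $X$ with $m$ columns, $\mathbf{u}$ is the unit roundoff, $\gamma_k=\frac{k\mathbf{u}}{1-k\mathbf{u}}$, $|A|$ is the entrywise absolute value (inequalities between such matrices are entrywise), hats denote computed quantities. Algorithm $\texttt{randQR}$ with a single sketch $S$ (the two-sketch algorithm with $S_1=S$, $S_2=I_p$): (1) compute $W=SV$; (2) compute a Householder QR factorization of $W$, keeping its $m\times m$ upper triangular factor $R$; (3) compute $Q=VR^{-1}$ by solving the triangular system $QR=V$ row by row. Output $Q,R$. Algorithm $\texttt{cholQR}(X)$: (1) compute $G=X^TX$; (2) compute the Cholesky factor $R$, $G=R^TR$; (3) compute $Q=XR^{-1}$ by solving $QR=X$ row by row. Output $Q,R$.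 Algorithm $\texttt{rand\_cholQR}$ with a single sketch $S$: (1) obtain $Q_0,R_0$ from $\texttt{randQR}$ applied to $V$ with sketch $S$; (2) $[Q,R_1]=\texttt{cholQR}(Q_0)$; (3) $R=R_1R_0$. Output $Q,R$. Floating point. All steps are executed in the standard model of floating point arithmetic with unit roundoff $\mathbf{u}$ (each elementary operation has relative error at most $\mathbf{u}$, no overflow or underflow). The standard rounding error bounds for the subroutines are: a computed product of matrices $A,B$ with inner dimension $k$ is $AB+\Delta C$ with $|\Delta C|\le\gamma_k|A||B|$; Householder QR of $\hat W\in\mathbb{R}^{p\times m}$ returns upper triangular $\hat R$ for which there is a $Q_{tmp}\in\mathbb{R}^{p\times m}$ with exactly orthonormal columns and $\hat W+E_2=Q_{tmp}\hat R$, where $\|(E_2)_j\|_2\le\gamma_{29pm}\|\hat w_j\|_2$ for each column $j$; the row-wise solution of $Q\hat R=V$ returns $\hat Q$ with $\hat Q_{i,:}(\hat R+\Delta R_i)=V_{i,:}$, $|\Delta R_i|\le\gamma_m|\hat R|$, for each row $i$; the Cholesky factorization of a computed $\hat G\in\mathbb{R}^{m\times m}$ returns $\hat R$ with $\hat R^T\hat R=\hat G+E$, $|E|\le\gamma_{m+1}|\hat R|^T|\hat R|$.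
   Formalization: The first bound is asserted only when 5445/(25√((1−ε)/(1+ε))−3)²·(nm+m(m+1))u < 1; the stated hypotheses do not force this as ε nears 616/634, and otherwise the bound has a zero denominator or the square root of a negative number. *)

theory Defs
  imports "HOL-Probability.Probability"
begin

text \<open>
  A matrix with rows indexed by \<open>'a\<close> and columns indexed by \<open>'b\<close> has type \<open>real^'b^'a\<close>.  On such
  matrices the library operations \<open>\<bar>A\<bar>\<close> and \<open>A \<le> B\<close> are entrywise.
\<close>

definition frobenius_norm :: "real^'b^'a \<Rightarrow> real" where
  "frobenius_norm A = sqrt (\<Sum>i\<in>UNIV. \<Sum>j\<in>UNIV. (A $ i $ j)\<^sup>2)"

text \<open>
  The singular values of a matrix \<open>X\<close> with \<open>m\<close> columns and at least \<open>m\<close> rows are the nonnegative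
  square roots of the eigenvalues of \<open>X\<^sup>T X\<close>.  Counted with multiplicity there are \<open>m\<close> of them, and
  the first and last in decreasing order are the maximum and minimum of this finite set.
\<close>

definition singular_values :: "real^'b^'a \<Rightarrow> real set" where
  "singular_values X =
     {s. 0 \<le> s \<and> (\<exists>v. v \<noteq> 0 \<and> (transpose X ** X) *v v = s\<^sup>2 *\<^sub>R v)}"

definition sigma_max :: "real^'b^'a \<Rightarrow> real" where
  "sigma_max X = Max (singular_values X)"

definition sigma_min :: "real^'b^'a \<Rightarrow> real" where
  "sigma_min X = Min (singular_values X)"

text \<open>
  The condition number is extended-real valued: division by zero on \<open>real\<close> would make it \<open>0\<close>
  for a rank deficient matrix, and upper bounds on it would then hold for the wrong reason.
\<close>

definition cond_num :: "real^'b^'a \<Rightarrow> ereal" where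
  "cond_num X = (if sigma_min X = 0 then \<infinity> else ereal (sigma_max X / sigma_min X))"

definition subspace_embedding :: "real \<Rightarrow> real^'n^'p \<Rightarrow> (real^'n) set \<Rightarrow> bool" where
  "subspace_embedding \<epsilon> S U \<longleftrightarrow>
     (\<forall>x\<in>U. \<forall>y\<in>U. \<bar>x \<bullet> y - (S *v x) \<bullet> (S *v y)\<bar> \<le> \<epsilon> * norm x * norm y)"

definition oblivious_embedding ::
  "'w measure \<Rightarrow> ('w \<Rightarrow> real^'n^'p) \<Rightarrow> real \<Rightarrow> real \<Rightarrow> nat \<Rightarrow> bool" where
  "oblivious_embedding M S \<epsilon> d m \<longleftrightarrow>
     S \<in> borel_measurable M \<and>
     (\<forall>U. subspace U \<and> dim U = m \<longrightarrow>
        measure M {\<omega> \<in> space M. subspace_embedding \<epsilon> (S \<omega>) U} \<ge> 1 - d)"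

text \<open>
  ``\<open>P\<close> holds with probability at least \<open>q\<close>'', stated so that it is meaningful even if the set where
  \<open>P\<close> holds is not itself an event (below, \<open>P\<close> quantifies over all admissible rounding errors).
\<close>

definition holds_with_prob :: "'w measure \<Rightarrow> real \<Rightarrow> ('w \<Rightarrow> bool) \<Rightarrow> bool" where
  "holds_with_prob M q P \<longleftrightarrow> (\<exists>A\<in>sets M. q \<le> measure M A \<and> (\<forall>\<omega>\<in>A. P \<omega>))"

definition gam :: "real \<Rightarrow> nat \<Rightarrow> real" where
  "gam u k = real k * u / (1 - real k * u)"

definition upper_tri :: "real^'m::{finite,linorder}^'m::{finite,linorder} \<Rightarrow> bool" where
  "upper_tri R \<longleftrightarrow> (\<forall>i j. j < i \<longrightarrow> R $ i $ j = 0)"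

text \<open>
  Each \<open>fl_\<close> predicate relates the inputs of a subroutine to the outputs it may compute in floating
  point arithmetic with unit roundoff \<open>u\<close>, as delimited by its standard rounding error bound; the
  computed quantities are the last arguments.
\<close>

definition fl_matmul :: "real \<Rightarrow> real^'k^'a \<Rightarrow> real^'b^'k \<Rightarrow> real^'b^'a \<Rightarrow> bool" where
  "fl_matmul u A B C \<longleftrightarrow>
     (\<exists>\<Delta>C. C = A ** B + \<Delta>C \<and> \<bar>\<Delta>C\<bar> \<le> gam u CARD('k) *\<^sub>R (\<bar>A\<bar> ** \<bar>B\<bar>))"

definition fl_householder_qr ::
  "real \<Rightarrow> real^'m::{finite,linorder}^'p
    \<Rightarrow> real^'m::{finite,linorder}^'m::{finite,linorder} \<Rightarrow> bool" where
  "fl_householder_qr u W R \<longleftrightarrow>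
     upper_tri R \<and>
     (\<exists>(Qtmp :: real^'m::{finite,linorder}^'p) E.
        transpose Qtmp ** Qtmp = mat 1 \<and>
        W + E = Qtmp ** R \<and>
        (\<forall>j. norm (column j E) \<le> gam u (29 * CARD('p) * CARD('m)) * norm (column j W)))"

text \<open>
  Solution of \<open>Q R = X\<close> for \<open>Q\<close> row by row; the backward error \<open>\<Delta>R\<close> depends on the row.
\<close>

definition fl_row_solve ::
  "real \<Rightarrow> real^'m^'n \<Rightarrow> real^'m^'m \<Rightarrow> real^'m^'n \<Rightarrow> bool" where
  "fl_row_solve u X R Q \<longleftrightarrow>
     (\<forall>i. \<exists>\<Delta>R. row i Q v* (R + \<Delta>R) = row i X \<and> \<bar>\<Delta>R\<bar> \<le> gam u CARD('m) *\<^sub>R \<bar>R\<bar>)"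

definition fl_cholesky ::
  "real \<Rightarrow> real^'m::{finite,linorder}^'m::{finite,linorder}
    \<Rightarrow> real^'m::{finite,linorder}^'m::{finite,linorder} \<Rightarrow> bool" where
  "fl_cholesky u G R \<longleftrightarrow>
     upper_tri R \<and>
     (\<exists>E. transpose R ** R = G + E \<and>
        \<bar>E\<bar> \<le> gam u (CARD('m) + 1) *\<^sub>R (transpose \<bar>R\<bar> ** \<bar>R\<bar>))"

definition fl_randQR ::
  "real \<Rightarrow> real^'n^'p \<Rightarrow> real^'m::{finite,linorder}^'n \<Rightarrow> real^'m::{finite,linorder}^'n
    \<Rightarrow> real^'m::{finite,linorder}^'m::{finite,linorder} \<Rightarrow> bool" where
  "fl_randQR u S V Q R \<longleftrightarrow>
     (\<exists>W. fl_matmul u S V W \<and> fl_householder_qr u W R \<and> fl_row_solve u V R Q)"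

definition fl_cholQR ::
  "real \<Rightarrow> real^'m::{finite,linorder}^'n \<Rightarrow> real^'m::{finite,linorder}^'n
    \<Rightarrow> real^'m::{finite,linorder}^'m::{finite,linorder} \<Rightarrow> bool" where
  "fl_cholQR u X Q R \<longleftrightarrow>
     (\<exists>G. fl_matmul u (transpose X) X G \<and> fl_cholesky u G R \<and> fl_row_solve u X R Q)"

definition fl_rand_cholQR ::
  "real \<Rightarrow> real^'n^'p \<Rightarrow> real^'m::{finite,linorder}^'n \<Rightarrow> real^'m::{finite,linorder}^'n
    \<Rightarrow> real^'m::{finite,linorder}^'m::{finite,linorder} \<Rightarrow> bool" where
  "fl_rand_cholQR u S V Q R \<longleftrightarrow>
     (\<exists>Q0 R0 R1. fl_randQR u S V Q0 R0 \<and> fl_cholQR u Q0 Q R1 \<and> fl_matmul u R1 R0 R)"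

definition delta :: "real \<Rightarrow> real \<Rightarrow> real^'n^'p \<Rightarrow> real^'m^'n \<Rightarrow> ereal" where
  "delta u \<epsilon> S V =
     (let n = real CARD('n); p = real CARD('p); m = real CARD('m) in
      ereal (383 * (p * m powr (3/2)
                    + sqrt m * (p powr (3/2) * sqrt (1 + \<epsilon>) + n * frobenius_norm S))
             / sqrt (1 - \<epsilon>) * u)
      * cond_num V)"

end

theory Submission
  imports Defs
begin

text \<open>
  On the event that \<open>S\<close> embeds the range of \<open>V\<close>, \<open>\<delta> \<le> 1\<close> makes the rounding errors of
  \<open>randQR\<close> small relative to \<open>sqrt (1 - \<epsilon>)\<close> times the smallest singular value of \<open>V\<close>, so that
  \<open>norm (R0 x)\<close> and \<open>norm (S V x)\<close> agree up to about \<open>14\<close> percent and the computed \<open>Q0\<close> satisfies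
  \<open>\<kappa>(Q0) \<le> k\<close> with \<open>k = 33 / (25 sqrt ((1 - \<epsilon>) / (1 + \<epsilon>)) - 3)\<close>.  Put
  \<open>t = k\<^sup>2 (n m + m (m + 1)) u\<close>; then \<open>c = 5 t\<close>.  In \<open>cholQR\<close> the computed factor satisfies
  \<open>R\<^sup>T R = X\<^sup>T X + F\<close> with \<open>\<bar>z \<bullet> F z\<bar> \<le> 1.152 t (norm (X z))\<^sup>2\<close>, and the triangular solve adds a
  relative perturbation of at most \<open>0.46 t\<close>.  The singular values of \<open>Q\<close> therefore lie in
  \<open>[1 - 1.11 t, 1 + 1.28 t]\<close>, which for \<open>t < 1 / 5\<close> is more than what is needed.
\<close>

section \<open>Frobenius norm and singular values\<close>

text \<open>The library norm on matrices is the Frobenius norm, the L2 norm of the row norms, so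
  Cauchy-Schwarz on each row suffices. Operator norms are not introduced as objects; they enter as
  hypotheses \<open>norm (A *v x) \<le> \<beta> * norm x\<close>.\<close>

lemma norm_matrix_vector_le:
  fixes A :: "real^'b^'a"
  shows "norm (A *v x) \<le> norm A * norm x"
proof -
  have "norm (A *v x) = L2_set (\<lambda>i. norm (A $ i \<bullet> x)) UNIV"
    by (simp add: norm_vec_def matrix_vector_mul_component)
  also have "\<dots> \<le> L2_set (\<lambda>i. norm (A $ i) * norm x) UNIV"
    by (intro L2_set_mono) (auto intro: Cauchy_Schwarz_ineq2)
  also have "\<dots> = norm A * norm x"
    by (simp add: norm_vec_def[of A] L2_set_left_distrib)
  finally show ?thesis .
qed

text \<open>A matrix and its transpose have the same operator norm: pair \<open>x v* A\<close> with
  itself, move \<open>A\<close> to the other side of the inner product and cancel one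
  factor.\<close>

lemma norm_vector_matrix_le_of_matrix_vector_le:
  fixes A :: "real^'b^'a"
  assumes "\<And>x. norm (A *v x) \<le> \<beta> * norm x"
  shows "norm (x v* A) \<le> \<beta> * norm x"
proof (cases "x v* A = 0")
  case True
  have "0 \<le> \<beta> * norm x"
  proof -
    have "0 \<le> norm (A *v axis undefined 1)" by simp
    also have "\<dots> \<le> \<beta>" using assms[of "axis undefined 1"] by simp
    finally show ?thesis by simp
  qed
  then show ?thesis using True by simp
next
  case False
  have "norm (x v* A) * norm (x v* A) = x \<bullet> (A *v (x v* A))"
    by (simp add: dot_lmul_matrix[symmetric] dot_square_norm power2_eq_square)
  also have "\<dots> \<le> norm x * (\<beta> * norm (x v* A))"
    by (rule order_trans[OF norm_cauchy_schwarz]) (intro mult_left_mono assms norm_ge_zero)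
  finally show ?thesis using False by (simp add: mult.commute mult.left_commute)
qed

lemma matrix_matrix_mult_nth: "(A ** B) $ i = A $ i v* B"
  by (simp add: vec_eq_iff matrix_matrix_mult_def vector_matrix_mult_def)

lemma matrix_add_rdistrib: "((A :: real^'k^'a) + B) ** C = A ** C + B ** C"
  by (simp add: vec_eq_iff matrix_matrix_mult_def sum.distrib distrib_right)

text \<open>The operator norm acts on each row of \<open>A\<close>. Using it for \<open>B\<close> in
  place of the Frobenius norm avoids a factor of the square root of the dimension, which matters
  when \<open>B\<close> is an inverse.\<close>

lemma norm_matrix_mult_le_of_vector_le:
  fixes A :: "real^'k^'a" and B :: "real^'b^'k"
  assumes "\<And>x. norm (B *v x) \<le> \<beta> * norm x"
  shows "norm (A ** B) \<le> norm A * \<beta>"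
proof -
  have b: "0 \<le> \<beta>"
    using order_trans[OF norm_ge_zero assms[of "axis undefined 1"]] by simp
  have "norm (A ** B) = L2_set (\<lambda>i. norm (A $ i v* B)) UNIV"
    by (simp add: norm_vec_def[of "A ** B"] matrix_matrix_mult_nth)
  also have "\<dots> \<le> L2_set (\<lambda>i. norm (A $ i) * \<beta>) UNIV"
    using norm_vector_matrix_le_of_matrix_vector_le[OF assms]
    by (intro L2_set_mono) (auto simp: mult.commute)
  also have "\<dots> = norm A * \<beta>"
    by (simp add: norm_vec_def[of A] L2_set_left_distrib b)
  finally show ?thesis .
qed

lemma norm_matrix_mult_le:
  fixes A :: "real^'k^'a" and B :: "real^'b^'k"
  shows "norm (A ** B) \<le> norm A * norm B"
  by (rule norm_matrix_mult_le_of_vector_le[OF norm_matrix_vector_le])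

lemma norm_vector_matrix_le:
  fixes A :: "real^'b^'a"
  shows "norm (x v* A) \<le> norm x * norm A"
  using norm_vector_matrix_le_of_matrix_vector_le[OF norm_matrix_vector_le, of x A]
  by (simp add: mult.commute)

section \<open>The Frobenius norm through entries, columns and traces\<close>

lemma power2_norm_matrix:
  fixes A :: "real^'b^'a"
  shows "(norm A)\<^sup>2 = (\<Sum>i\<in>UNIV. \<Sum>j\<in>UNIV. (A $ i $ j)\<^sup>2)"
  by (simp add: norm_vec_def L2_set_def sum_nonneg)

lemma frobenius_norm_eq_norm: "frobenius_norm A = norm A"
  by (simp add: frobenius_norm_def power2_norm_matrix[symmetric])

lemma power2_norm_matrix_columns:
  fixes A :: "real^'b^'a"
  shows "(norm A)\<^sup>2 = (\<Sum>j\<in>UNIV. (norm (column j A))\<^sup>2)"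
proof -
  have "(norm (column j A))\<^sup>2 = (\<Sum>i\<in>UNIV. (A $ i $ j)\<^sup>2)" for j
    by (simp add: norm_vec_def L2_set_def sum_nonneg column_def)
  then show ?thesis
    unfolding power2_norm_matrix by (simp add: sum.swap[of _ "UNIV :: 'a set"])
qed

lemma norm_transpose:
  fixes A :: "real^'b^'a"
  shows "norm (transpose A) = norm A"
proof -
  have "(norm (transpose A))\<^sup>2 = (norm A)\<^sup>2"
    unfolding power2_norm_matrix
    by (simp add: transpose_def sum.swap[of _ "UNIV :: 'a set"])
  then show ?thesis by simp
qed

text \<open>Serves the backward error of Householder QR, which is bounded column by column.\<close>

lemma norm_le_columnwise:
  fixes A :: "real^'b^'a" and B :: "real^'b^'c"
  assumes "0 \<le> g" "\<And>j. norm (column j A) \<le> g * norm (column j B)"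
  shows "norm A \<le> g * norm B"
proof (rule power2_le_imp_le)
  have "(norm A)\<^sup>2 \<le> (\<Sum>j\<in>UNIV. (g * norm (column j B))\<^sup>2)"
    unfolding power2_norm_matrix_columns by (intro sum_mono power_mono assms) auto
  also have "\<dots> = (g * norm B)\<^sup>2"
    by (simp add: power_mult_distrib power2_norm_matrix_columns sum_distrib_left)
  finally show "(norm A)\<^sup>2 \<le> (g * norm B)\<^sup>2" .
qed (simp add: assms)

text \<open>Every column is the image of a unit vector. The factors \<open>sqrt m\<close> in the
  later estimates enter here.\<close>

lemma norm_matrix_le_sqrt_card:
  fixes A :: "real^'b^'a"
  assumes "\<And>x. norm (A *v x) \<le> b * norm x"
  shows "norm A \<le> sqrt CARD('b) * b"
proof (rule power2_le_imp_le)
  have *: "norm (column j A) \<le> b" for j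
    using assms[of "axis j 1"] by (simp add: matrix_vector_mult_basis)
  then have b: "0 \<le> b" using order_trans[OF norm_ge_zero] by blast
  have "(norm A)\<^sup>2 \<le> (\<Sum>j\<in>(UNIV::'b set). b\<^sup>2)"
    unfolding power2_norm_matrix_columns by (intro sum_mono power_mono * norm_ge_zero)
  then show "(norm A)\<^sup>2 \<le> (sqrt CARD('b) * b)\<^sup>2"
    by (simp add: power_mult_distrib)
  show "0 \<le> sqrt CARD('b) * b" using b by simp
qed

lemma norm_matrix_le_entrywise:
  fixes A B :: "real^'b^'a"
  assumes "\<bar>A\<bar> \<le> B"
  shows "norm A \<le> norm B"
proof -
  have "\<bar>A $ i $ j\<bar> \<le> B $ i $ j" for i j
    using assms by (simp add: less_eq_vec_def abs_vec_def)
  then have "norm (A $ i $ j) \<le> norm (B $ i $ j)" for i j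
    by (metis abs_ge_self order_trans real_norm_def)
  then show ?thesis by (intro norm_le_componentwise_cart)
qed

lemma norm_matrix_abs:
  fixes A :: "real^'b^'a"
  shows "norm \<bar>A\<bar> = norm A"
proof -
  have "(norm \<bar>A\<bar>)\<^sup>2 = (norm A)\<^sup>2"
    unfolding power2_norm_matrix by (simp add: abs_vec_def)
  then show ?thesis by simp
qed

lemma trace_transpose_mult:
  fixes A :: "real^'b^'a"
  shows "trace (transpose A ** A) = (norm A)\<^sup>2"
  by (simp add: trace_def power2_norm_matrix_columns matrix_mult_transpose_dot_column dot_square_norm)

lemma abs_trace_le:
  fixes A B :: "real^'a^'a"
  assumes "\<bar>A\<bar> \<le> B"
  shows "\<bar>trace A\<bar> \<le> trace B"
proof -
  have "\<bar>trace A\<bar> \<le> (\<Sum>i\<in>UNIV. \<bar>A $ i $ i\<bar>)"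
    by (simp add: trace_def sum_abs)
  also have "\<dots> \<le> trace B"
    using assms unfolding trace_def by (intro sum_mono) (simp add: less_eq_vec_def abs_vec_def)
  finally show ?thesis .
qed

text \<open>The lower bound forces a trivial kernel, and for a square matrix a left inverse is also
  a right inverse. The same bound at \<open>P *v y\<close> controls the inverse.\<close>

lemma exists_inverse_of_bounded_below:
  fixes R :: "real^'m^'m"
  assumes "0 < \<rho>" "\<And>x. \<rho> * norm x \<le> norm (R *v x)"
  obtains P where "R ** P = mat 1" "\<And>y. norm (P *v y) \<le> norm y / \<rho>"
proof -
  have "x = 0" if "R *v x = 0" for x
    using assms(2)[of x] that assms(1) by (simp add: mult_le_0_iff)
  then obtain P where "P ** R = mat 1"
    unfolding matrix_left_invertible_ker[symmetric] using matrix_left_invertible_ker by blast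
  then have P: "R ** P = mat 1" by (simp add: matrix_left_right_inverse)
  moreover have "norm (P *v y) \<le> norm y / \<rho>" for y
    using assms(2)[of "P *v y"] assms(1)
    by (simp add: matrix_vector_mul_assoc P field_simps)
  ultimately show ?thesis using that by blast
qed

text \<open>
  Applied to \<open>s\<^sup>2 I - X\<^sup>T X\<close> and its negative, this turns an extremal vector of \<open>norm (X v)\<close> on the
  unit sphere into an eigenvector.
\<close>

lemma psd_null_vector:
  fixes B :: "real^'m^'m"
  assumes sym: "transpose B = B" and psd: "\<And>x. 0 \<le> x \<bullet> (B *v x)" and v: "v \<bullet> (B *v v) = 0"
  shows "B *v v = 0"
proof (rule ccontr)
  define w where "w = B *v v"
  assume "B *v v \<noteq> 0"
  then have N: "0 < w \<bullet> w" by (simp add: w_def)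
  define K where "K = w \<bullet> (B *v w)"
  have vBw: "v \<bullet> (B *v w) = w \<bullet> w"
    by (metis dot_lmul_matrix transpose_matrix_vector sym w_def)
  have "0 \<le> - 2 * t * (w \<bullet> w) + t\<^sup>2 * K" for t :: real
  proof -
    have "0 \<le> (v - t *\<^sub>R w) \<bullet> (B *v (v - t *\<^sub>R w))" by (rule psd)
    also have "\<dots> = - 2 * t * (w \<bullet> w) + t\<^sup>2 * K"
      using v vBw by (simp add: matrix_vector_mult_diff_distrib matrix_vector_mult_scaleR inner_diff_left
            inner_diff_right K_def power2_eq_square algebra_simps flip: w_def)
    finally show ?thesis .
  qed
  \<comment> \<open>For small positive \<open>t\<close> the linear term wins. With this choice the
    quadratic term is at most \<open>t * (w \<bullet> w)\<close>, half the size of the linear one,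
    so the form would be negative.\<close>
  moreover define t where "t = (w \<bullet> w) / (\<bar>K\<bar> + 1)"
  ultimately have "0 \<le> - 2 * t * (w \<bullet> w) + t\<^sup>2 * K" by blast
  moreover have t: "0 < t" using N by (simp add: t_def)
  moreover have "t\<^sup>2 * K \<le> t\<^sup>2 * (\<bar>K\<bar> + 1)" by (intro mult_left_mono) auto
  moreover have "t\<^sup>2 * (\<bar>K\<bar> + 1) = t * (w \<bullet> w)"
    by (simp add: t_def power2_eq_square)
  moreover have "0 < t * (w \<bullet> w)" using t N by simp
  ultimately show False by simp
qed

section \<open>Singular values as extrema of \<open>norm (X *v x)\<close> on the unit sphere\<close>

lemma inner_gram:
  fixes X :: "real^'m^'n"
  shows "x \<bullet> ((transpose X ** X) *v y) = (X *v x) \<bullet> (X *v y)"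
proof -
  have "x \<bullet> ((transpose X ** X) *v y) = x \<bullet> (transpose X *v (X *v y))"
    by (simp only: matrix_vector_mul_assoc)
  also have "\<dots> = (x v* transpose X) \<bullet> (X *v y)" by (simp only: dot_lmul_matrix)
  finally show ?thesis by simp
qed

lemma singular_value_norm:
  assumes "s \<in> singular_values X"
  obtains v where "v \<noteq> 0" "norm (X *v v) = s * norm v"
proof -
  obtain v where v: "v \<noteq> 0" "(transpose X ** X) *v v = s\<^sup>2 *\<^sub>R v" and s: "0 \<le> s"
    using assms by (auto simp: singular_values_def)
  have "(norm (X *v v))\<^sup>2 = (s * norm v)\<^sup>2"
    using inner_gram[of v X v] unfolding v(2) by (simp add: dot_square_norm power_mult_distrib)
  then have "norm (X *v v) = s * norm v" using s by simp
  then show ?thesis using that v by blast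
qed

text \<open>Eigenvectors of \<open>transpose X ** X\<close> for different eigenvalues are
  orthogonal, so one eigenvector per singular value gives an independent family. Finiteness is what
  gives \<open>Max\<close> and \<open>Min\<close> their meaning.\<close>

lemma finite_singular_values: "finite (singular_values (X :: real^'m^'n))"
proof -
  let ?S = "singular_values X"
  have "\<forall>s\<in>?S. \<exists>v. v \<noteq> 0 \<and> (transpose X ** X) *v v = s\<^sup>2 *\<^sub>R v"
    by (auto simp: singular_values_def)
  then obtain f where f: "\<And>s. s \<in> ?S \<Longrightarrow> f s \<noteq> 0"
      "\<And>s. s \<in> ?S \<Longrightarrow> (transpose X ** X) *v f s = s\<^sup>2 *\<^sub>R f s"
    by metis
  have orth: "f s \<bullet> f t = 0" if "s \<in> ?S" "t \<in> ?S" "s \<noteq> t" for s t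
  proof -
    have "t\<^sup>2 * (f s \<bullet> f t) = s\<^sup>2 * (f s \<bullet> f t)"
      using inner_gram[of "f s" X "f t"] inner_gram[of "f t" X "f s"] f(2) that
      by (simp add: inner_commute)
    \<comment> \<open>Nonnegativity of singular values excludes \<open>s = - t\<close>.\<close>
    moreover have "s\<^sup>2 \<noteq> t\<^sup>2" using that by (auto simp: singular_values_def power2_eq_iff)
    ultimately show ?thesis by auto
  qed
  have inj: "inj_on f ?S"
    by (rule inj_onI) (metis orth f(1) inner_eq_zero_iff)
  have "pairwise orthogonal (f ` ?S)"
    unfolding pairwise_def orthogonal_def using orth by fastforce
  moreover have "0 \<notin> f ` ?S" using f(1) by fastforce
  ultimately have "independent (f ` ?S)" by (rule pairwise_orthogonal_independent)
  then have "finite (f ` ?S)" by (rule independent_imp_finite)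
  then show ?thesis using inj finite_image_iff by blast
qed

text \<open>Compactness of the sphere provides a maximiser, and \<open>psd_null_vector\<close> makes
  it an eigenvector. This also shows that the set of singular values is nonempty.\<close>

lemma singular_value_max_ex:
  fixes X :: "real^'m^'n"
  obtains s where "s \<in> singular_values X" "\<And>x. norm (X *v x) \<le> s * norm x"
proof -
  have "compact (sphere (0::real^'m) 1)" "sphere (0::real^'m) 1 \<noteq> {}"
    using norm_axis_1[of undefined] by (auto intro!: exI[of _ "axis undefined 1"])
  moreover have "continuous_on (sphere 0 1) (\<lambda>x. norm (X *v x))"
    by (intro continuous_intros)
  ultimately obtain v where v: "norm v = 1" "\<And>y. norm y = 1 \<Longrightarrow> norm (X *v y) \<le> norm (X *v v)"
    using continuous_attains_sup[of "sphere (0::real^'m) 1" "\<lambda>x. norm (X *v x)"] by auto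
  define s where "s = norm (X *v v)"
  have le: "norm (X *v x) \<le> s * norm x" for x
  proof (cases "x = 0")
    case False
    then show ?thesis using v(2)[of "inverse (norm x) *\<^sub>R x"]
      by (simp add: matrix_vector_mult_scaleR s_def field_simps)
  qed simp
  define B where "B = s\<^sup>2 *\<^sub>R mat 1 - transpose X ** X"
  have B: "B *v x = s\<^sup>2 *\<^sub>R x - (transpose X ** X) *v x" for x
    by (simp add: B_def matrix_vector_mult_diff_rdistrib scaleR_matrix_vector_assoc[symmetric])
  have q: "x \<bullet> (B *v x) = (s * norm x)\<^sup>2 - (norm (X *v x))\<^sup>2" for x
    by (simp only: B inner_diff_right inner_gram) (simp add: dot_square_norm power_mult_distrib)
  have "B *v v = 0"
  proof (rule psd_null_vector)
    show "transpose B = B"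
      by (simp add: B_def transpose_def vec_eq_iff mat_def matrix_matrix_mult_def mult.commute)
    show "0 \<le> x \<bullet> (B *v x)" for x using le[of x] by (simp add: q power_mono)
    show "v \<bullet> (B *v v) = 0" using v(1) by (simp add: q s_def)
  qed
  then have "s \<in> singular_values X"
    using v(1) by (auto simp: singular_values_def s_def B intro!: exI[of _ v])
  then show ?thesis using le that by blast
qed

lemma singular_value_min_ex:
  fixes X :: "real^'m^'n"
  obtains s where "s \<in> singular_values X" "\<And>x. s * norm x \<le> norm (X *v x)"
proof -
  have "compact (sphere (0::real^'m) 1)" "sphere (0::real^'m) 1 \<noteq> {}"
    using norm_axis_1[of undefined] by (auto intro!: exI[of _ "axis undefined 1"])
  moreover have "continuous_on (sphere 0 1) (\<lambda>x. norm (X *v x))"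
    by (intro continuous_intros)
  ultimately obtain v where v: "norm v = 1" "\<And>y. norm y = 1 \<Longrightarrow> norm (X *v v) \<le> norm (X *v y)"
    using continuous_attains_inf[of "sphere (0::real^'m) 1" "\<lambda>x. norm (X *v x)"] by auto
  define s where "s = norm (X *v v)"
  have le: "s * norm x \<le> norm (X *v x)" for x
  proof (cases "x = 0")
    case False
    then show ?thesis using v(2)[of "inverse (norm x) *\<^sub>R x"]
      by (simp add: matrix_vector_mult_scaleR s_def field_simps)
  qed simp
  define B where "B = transpose X ** X - s\<^sup>2 *\<^sub>R mat 1"
  have B: "B *v x = (transpose X ** X) *v x - s\<^sup>2 *\<^sub>R x" for x
    by (simp add: B_def matrix_vector_mult_diff_rdistrib scaleR_matrix_vector_assoc[symmetric])
  have q: "x \<bullet> (B *v x) = (norm (X *v x))\<^sup>2 - (s * norm x)\<^sup>2" for x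
    by (simp only: B inner_diff_right inner_gram) (simp add: dot_square_norm power_mult_distrib)
  have "B *v v = 0"
  proof (rule psd_null_vector)
    show "transpose B = B"
      by (simp add: B_def transpose_def vec_eq_iff mat_def matrix_matrix_mult_def mult.commute)
    show "0 \<le> x \<bullet> (B *v x)" for x
      using le[of x] by (simp add: q s_def power_mono)
    show "v \<bullet> (B *v v) = 0" using v(1) by (simp add: q s_def)
  qed
  then have "s \<in> singular_values X"
    using v(1) by (auto simp: singular_values_def s_def B intro!: exI[of _ v])
  then show ?thesis using le that by blast
qed

lemma sigma_max_upper: "norm (X *v x) \<le> sigma_max X * norm x"
proof -
  obtain s where "s \<in> singular_values X" "norm (X *v x) \<le> s * norm x"
    using singular_value_max_ex by metis
  moreover from this have "s \<le> sigma_max X"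
    unfolding sigma_max_def by (simp add: finite_singular_values)
  ultimately show ?thesis
    by (meson mult_right_mono norm_ge_zero order_trans)
qed

lemma sigma_min_lower: "sigma_min X * norm x \<le> norm (X *v x)"
proof -
  obtain s where "s \<in> singular_values X" "s * norm x \<le> norm (X *v x)"
    using singular_value_min_ex by metis
  moreover from this have "sigma_min X \<le> s"
    unfolding sigma_min_def by (simp add: finite_singular_values)
  ultimately show ?thesis
    by (meson mult_right_mono norm_ge_zero order_trans)
qed

lemma sigma_max_in: "sigma_max X \<in> singular_values X"
  unfolding sigma_max_def using singular_value_max_ex[of X]
  by (metis Max_in empty_iff finite_singular_values)

lemma sigma_min_in: "sigma_min X \<in> singular_values X"
  unfolding sigma_min_def using singular_value_max_ex[of X]
  by (metis Min_in empty_iff finite_singular_values)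

text \<open>The extreme singular values are attained at nonzero vectors, so two-sided bounds pass to
  them. Positivity of \<open>L\<close> excludes the infinite case.\<close>

lemma cond_num_le:
  assumes "0 < L" "\<And>x. L * norm x \<le> norm (X *v x)" "\<And>x. norm (X *v x) \<le> U * norm x"
  shows "cond_num X \<le> ereal (U / L)"
proof -
  obtain v where v: "v \<noteq> 0" "norm (X *v v) = sigma_max X * norm v"
    using singular_value_norm sigma_max_in by blast
  have U: "sigma_max X \<le> U" using assms(3)[of v] v by simp
  obtain w where w: "w \<noteq> 0" "norm (X *v w) = sigma_min X * norm w"
    using singular_value_norm sigma_min_in by blast
  have L: "L \<le> sigma_min X" using assms(2)[of w] w by simp
  have "0 \<le> sigma_max X" using sigma_max_in[of X] by (simp add: singular_values_def)
  then have "sigma_max X / sigma_min X \<le> U / L"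
    using U L assms(1) by (intro frac_le) auto
  then show ?thesis using L assms(1) by (simp add: cond_num_def)
qed

lemma sigma_min_pos:
  assumes "\<And>x. X *v x = 0 \<Longrightarrow> x = 0"
  shows "0 < sigma_min X"
proof -
  obtain w where w: "w \<noteq> 0" "norm (X *v w) = sigma_min X * norm w"
    using singular_value_norm sigma_min_in by blast
  have "sigma_min X \<noteq> 0" using w assms by auto
  then show ?thesis using sigma_min_in[of X] by (simp add: singular_values_def)
qed


section \<open>Rounding errors in norm\<close>

text \<open>Replaces the rational \<open>gam\<close> by a linear function of \<open>u\<close>; each
  caller supplies a numerical bound \<theta> on \<open>real k * u\<close>.\<close>

lemma gam_bounds:
  assumes "0 \<le> u" "real k * u \<le> \<theta>" "\<theta> < 1"
  shows "0 \<le> gam u k" "gam u k \<le> real k * u / (1 - \<theta>)"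
  using assms by (auto simp: gam_def intro!: divide_nonneg_pos divide_left_mono mult_pos_pos)

lemma fl_matmul_norm:
  fixes A :: "real^'k^'a" and B :: "real^'b^'k"
  assumes "fl_matmul u A B C" "0 \<le> gam u CARD('k)"
  shows "norm (C - A ** B) \<le> gam u CARD('k) * (norm A * norm B)"
proof -
  obtain D where D: "C = A ** B + D" "\<bar>D\<bar> \<le> gam u CARD('k) *\<^sub>R (\<bar>A\<bar> ** \<bar>B\<bar>)"
    using assms(1) by (auto simp: fl_matmul_def)
  have "norm D \<le> gam u CARD('k) * norm (\<bar>A\<bar> ** \<bar>B\<bar>)"
    using norm_matrix_le_entrywise[OF D(2)] assms(2) by simp
  also have "\<dots> \<le> gam u CARD('k) * (norm A * norm B)"
    using norm_matrix_mult_le[of "\<bar>A\<bar>" "\<bar>B\<bar>"] assms(2)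
    by (intro mult_left_mono) (simp_all add: norm_matrix_abs)
  finally show ?thesis by (simp add: D(1))
qed

text \<open>Each row has its own perturbation of \<open>R\<close>, so \<open>Q\<close> need not
  solve one perturbed system. The rows are therefore bounded separately and collected in L2, which
  leaves the computed \<open>Q\<close> on the right-hand side.\<close>

lemma fl_row_solve_norm:
  fixes Q X :: "real^'m^'n"
  assumes "fl_row_solve u X R Q" and g: "0 \<le> gam u CARD('m)"
  shows "norm (Q ** R - X) \<le> gam u CARD('m) * norm R * norm Q"
proof -
  have *: "norm ((Q ** R - X) $ i) \<le> gam u CARD('m) * norm R * norm (Q $ i)" for i
  proof -
    obtain D where D: "Q $ i v* (R + D) = X $ i" "\<bar>D\<bar> \<le> gam u CARD('m) *\<^sub>R \<bar>R\<bar>"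
      using assms(1) by (auto simp: fl_row_solve_def row_def)
    have "(Q ** R - X) $ i = Q $ i v* R - X $ i" by (simp add: matrix_matrix_mult_nth)
    also have "\<dots> = - (Q $ i v* D)"
      by (simp add: D(1)[symmetric] vector_matrix_mult_add_rdistrib)
    finally have "norm ((Q ** R - X) $ i) \<le> norm (Q $ i) * norm D"
      by (simp add: norm_vector_matrix_le)
    also have "\<dots> \<le> norm (Q $ i) * (gam u CARD('m) * norm R)"
      using norm_matrix_le_entrywise[OF D(2)] g
      by (intro mult_left_mono) (simp_all add: norm_matrix_abs)
    finally show ?thesis by (simp add: mult_ac)
  qed
  have "norm (Q ** R - X) \<le> L2_set (\<lambda>i. gam u CARD('m) * norm R * norm (Q $ i)) UNIV"
    unfolding norm_vec_def[of "Q ** R - X"] by (intro L2_set_mono *) auto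
  also have "\<dots> = gam u CARD('m) * norm R * norm Q"
    by (simp add: norm_vec_def[of Q] L2_set_right_distrib g)
  finally show ?thesis .
qed

lemma norm_orthonormal_columns:
  fixes Q :: "real^'m^'p"
  assumes "transpose Q ** Q = mat 1"
  shows "norm (Q *v x) = norm x"
  using inner_gram[of x Q x] by (simp add: assms norm_eq_sqrt_inner)

text \<open>
  The backward error is relative to \<open>norm Q\<close> itself; for \<open>\<tau> < 1\<close> the resulting implicit bound on
  \<open>norm Q\<close> can be solved.
\<close>

lemma perturbed_solve_bounds:
  fixes Q X :: "real^'m^'n" and R :: "real^'m^'m"
  assumes E: "norm (Q ** R - X) \<le> g * norm R * norm Q"
    and R: "0 < \<rho>" "\<And>z. \<rho> * norm z \<le> norm (R *v z)"
    and l: "\<And>z. l * norm (R *v z) \<le> norm (X *v z)"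
    and h: "\<And>z. norm (X *v z) \<le> h * norm (R *v z)"
    and \<tau>: "0 \<le> \<tau>" "g * norm R / \<rho> \<le> \<tau>" "\<tau> < 1"
    and \<phi>: "sqrt CARD('m) * \<tau> / (1 - \<tau>) \<le> \<phi>" and h0: "0 \<le> h"
  shows "(l - h * \<phi>) * norm y \<le> norm (Q *v y)" "norm (Q *v y) \<le> h * (1 + \<phi>) * norm y"
proof -
  obtain P where P: "R ** P = mat 1" "\<And>y. norm (P *v y) \<le> norm y / \<rho>"
    using exists_inverse_of_bounded_below[OF R] by blast
  have XP: "norm ((X ** P) *v y) \<le> h * norm y" "l * norm y \<le> norm ((X ** P) *v y)" for y
    using l[of "P *v y"] h[of "P *v y"] by (simp_all add: matrix_vector_mul_assoc P)
  define F where "F = (Q ** R - X) ** P"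
  have "Q = (X + (Q ** R - X)) ** P"
    by (simp add: matrix_mul_assoc[symmetric] P)
  then have Q: "Q = X ** P + F"
    unfolding F_def by (simp only: matrix_add_rdistrib)
  \<comment> \<open>The residual is measured in the Frobenius norm, the inverse \<open>P\<close>
    only in the operator norm.\<close>
  have "norm F \<le> norm (Q ** R - X) * (1 / \<rho>)"
    unfolding F_def by (rule norm_matrix_mult_le_of_vector_le) (use P in simp)
  also have "\<dots> \<le> g * norm R * norm Q * (1 / \<rho>)"
    using E R(1) by (intro mult_right_mono) auto
  also have "\<dots> = g * norm R / \<rho> * norm Q" by simp
  also have "\<dots> \<le> \<tau> * norm Q" by (intro mult_right_mono \<tau>) simp
  finally have F: "norm F \<le> \<tau> * norm Q" .
  have "norm Q \<le> norm (X ** P) + norm F" unfolding Q by (rule norm_triangle_ineq)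
  also have "\<dots> \<le> sqrt CARD('m) * h + \<tau> * norm Q"
    by (intro add_mono F norm_matrix_le_sqrt_card XP)
  finally have "norm Q \<le> sqrt CARD('m) * h / (1 - \<tau>)"
    using \<tau>(3) by (simp add: field_simps)
  then have "\<tau> * norm Q \<le> \<tau> * (sqrt CARD('m) * h / (1 - \<tau>))" by (intro mult_left_mono \<tau>)
  also have "\<dots> = h * (sqrt CARD('m) * \<tau> / (1 - \<tau>))" by simp
  also have "\<dots> \<le> h * \<phi>" by (intro mult_left_mono \<phi> h0)
  finally have Fphi: "norm F \<le> h * \<phi>" using F by simp
  have Fy: "norm (F *v y) \<le> h * \<phi> * norm y"
    by (rule order_trans[OF norm_matrix_vector_le mult_right_mono[OF Fphi]]) simp
  have Qy: "Q *v y = (X ** P) *v y + F *v y"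
    by (subst Q) (simp add: matrix_vector_mult_add_rdistrib)
  show "norm (Q *v y) \<le> h * (1 + \<phi>) * norm y"
    unfolding Qy using norm_triangle_ineq[of "(X ** P) *v y" "F *v y"] XP(1)[of y] Fy
    by (simp add: algebra_simps)
  show "(l - h * \<phi>) * norm y \<le> norm (Q *v y)"
    unfolding Qy using norm_diff_ineq[of "(X ** P) *v y" "F *v y"] XP(2)[of y] Fy
    by (simp add: algebra_simps)
qed


section \<open>Conditioning of the computed factors\<close>

text \<open>The trace of \<open>transpose \<bar>A\<bar> ** \<bar>A\<bar>\<close> is exactly the
  squared Frobenius norm, so the trace bound loses no dimension factor. It serves to bound the
  computed Cholesky factor.\<close>

lemma gram_error_norm:
  fixes A :: "real^'m^'n" and D :: "real^'m^'m"
  assumes "\<bar>D\<bar> \<le> g *\<^sub>R (transpose \<bar>A\<bar> ** \<bar>A\<bar>)" "0 \<le> g"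
  shows "norm D \<le> g * (norm A)\<^sup>2" "\<bar>trace D\<bar> \<le> g * (norm A)\<^sup>2"
proof -
  have "norm D \<le> g * norm (transpose \<bar>A\<bar> ** \<bar>A\<bar>)"
    using norm_matrix_le_entrywise[OF assms(1)] assms(2) by simp
  also have "\<dots> \<le> g * (norm A)\<^sup>2"
    using norm_matrix_mult_le[of "transpose \<bar>A\<bar>" "\<bar>A\<bar>"] assms(2)
    by (intro mult_left_mono) (simp_all add: norm_matrix_abs norm_transpose power2_eq_square)
  finally show "norm D \<le> g * (norm A)\<^sup>2" .
  have "trace (g *\<^sub>R (transpose \<bar>A\<bar> ** \<bar>A\<bar>)) = g * trace (transpose \<bar>A\<bar> ** \<bar>A\<bar>)"
    by (simp add: trace_def sum_distrib_left)
  then show "\<bar>trace D\<bar> \<le> g * (norm A)\<^sup>2"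
    using abs_trace_le[OF assms(1)] by (simp add: trace_transpose_mult norm_matrix_abs)
qed

text \<open>Here \<open>a\<close> is a lower bound for the singular values of \<open>X\<close> and
  \<open>k\<close> bounds its condition number. The Gram and Cholesky errors scale with the squared
  Frobenius norm of \<open>X\<close>, at most \<open>m * (k * a)\<^sup>2\<close>, but are compared
  with \<open>(norm (X *v z))\<^sup>2\<close>, which may be as small as
  \<open>(a * norm z)\<^sup>2\<close>; hence the factor \<open>k\<^sup>2 * m\<close> in
  \<open>t\<close>.\<close>

lemma cholQR_bounds:
  fixes X Q :: "real^'m::{finite,linorder}^'n"
  assumes u: "0 < u" and dims: "1 < CARD('m)" "CARD('m) \<le> CARD('n)"
    and a: "0 < a" "\<And>x. a * norm x \<le> norm (X *v x)"
    and b: "\<And>x. norm (X *v x) \<le> k * a * norm x" and k: "3 / 2 \<le> k"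
    and t_def: "t = k\<^sup>2 * (real CARD('n) * real CARD('m) + real CARD('m) * (real CARD('m) + 1)) * u"
    and t: "t < 1 / 5"
    and fl: "fl_cholQR u X Q R"
  shows "(1 - 1.11 * t) * norm x \<le> norm (Q *v x)" "norm (Q *v x) \<le> (1 + 1.28 * t) * norm x"
proof -
  define m n where "m = real CARD('m)" and "n = real CARD('n)"
  have mn: "2 \<le> m" "m \<le> n" using dims by (auto simp: m_def n_def)
  have t0: "0 < t"
    unfolding t_def using u k mn by (intro mult_pos_pos add_pos_pos) (auto simp: m_def n_def)
  define y1 y2 where "y1 = n * u" and "y2 = (m + 1) * u"
  have y: "0 \<le> y1" "0 \<le> y2" using u mn by (auto simp: y1_def y2_def)
  have t_y: "t = k\<^sup>2 * m * (y1 + y2)"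
    by (simp add: t_def y1_def y2_def m_def n_def algebra_simps)
  \<comment> \<open>The factors come from \<open>k \<ge> 3 / 2\<close> and \<open>m \<ge> 2\<close>.
    Together with \<open>t < 1 / 5\<close> they give the bound \<open>2 / 45\<close> used for every
    \<open>gam\<close> below.\<close>
  have k2: "(9 / 4) * 2 \<le> k\<^sup>2 * m"
    using power_mono[OF k, of 2] mn by (intro mult_mono) (auto simp: power2_eq_square)
  then have "9 / 2 * (y1 + y2) \<le> t"
    unfolding t_y using y by (intro mult_right_mono) auto
  then have y12: "y1 + y2 \<le> 2 / 45" using t by simp
  define g1 g2 g3 where "g1 = gam u CARD('n)" and "g2 = gam u (CARD('m) + 1)"
    and "g3 = gam u CARD('m)"
  have g1: "0 \<le> g1" "g1 \<le> 1.0466 * y1"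
    using gam_bounds[of u "CARD('n)" "2 / 45"] u y y12 by (auto simp: g1_def y1_def n_def)
  have g2: "0 \<le> g2" "g2 \<le> 1.0466 * y2"
    using gam_bounds[of u "CARD('m) + 1" "2 / 45"] u y y12
    by (auto simp: g2_def y2_def m_def add.commute)
  have mu: "m * u \<le> y2" using u by (simp add: y2_def algebra_simps)
  then have g3: "0 \<le> g3" "g3 \<le> 1.0466 * (m * u)"
    using gam_bounds[of u "CARD('m)" "2 / 45"] u y y12 by (auto simp: g3_def m_def)
  obtain G where G: "fl_matmul u (transpose X) X G" "fl_cholesky u G R" "fl_row_solve u X R Q"
    using fl by (auto simp: fl_cholQR_def)
  define N where "N = (norm X)\<^sup>2"
  obtain D where D: "G = transpose X ** X + D" "\<bar>D\<bar> \<le> g1 *\<^sub>R (\<bar>transpose X\<bar> ** \<bar>X\<bar>)"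
    using G(1) by (auto simp: fl_matmul_def g1_def)
  have "\<bar>transpose X\<bar> = transpose \<bar>X\<bar>"
    by (simp add: abs_vec_def transpose_def)
  with D(2) have D1: "norm D \<le> g1 * N" "\<bar>trace D\<bar> \<le> g1 * N"
    using gram_error_norm[of D g1 X] g1 by (auto simp: N_def)
  obtain E where E: "transpose R ** R = G + E" "\<bar>E\<bar> \<le> g2 *\<^sub>R (transpose \<bar>R\<bar> ** \<bar>R\<bar>)"
    using G(2) by (auto simp: fl_cholesky_def g2_def)
  have E1: "norm E \<le> g2 * (norm R)\<^sup>2" "\<bar>trace E\<bar> \<le> g2 * (norm R)\<^sup>2"
    using gram_error_norm[OF E(2) g2(1)] by auto
  have N0: "0 \<le> N" by (simp add: N_def)
  \<comment> \<open>The bound on \<open>E\<close> involves \<open>R\<close> itself. Taking traces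
    gives a scalar inequality in which that term can be absorbed on the left.\<close>
  have "(norm R)\<^sup>2 = N + trace D + trace E"
    unfolding trace_transpose_mult[symmetric] E(1) D(1) N_def by (simp add: trace_add)
  then have "(norm R)\<^sup>2 * (1 - g2) \<le> N * (1 + g1)"
    using D1 E1 by (simp add: algebra_simps)
  also have "\<dots> \<le> N * (1.1 * (1 - g2))"
    using g1 g2 y y12 by (intro mult_left_mono N0) auto
  also have "\<dots> = 1.1 * N * (1 - g2)" by simp
  finally have R2: "(norm R)\<^sup>2 \<le> 1.1 * N" 
    by (rule mult_right_le_imp_le) (use g2 y y12 in simp)
  define F where "F = transpose R ** R - transpose X ** X"
  have "norm F \<le> norm D + norm E"
    unfolding F_def E(1) D(1) by (simp add: norm_triangle_ineq)
  also have "\<dots> \<le> g1 * N + g2 * (1.1 * N)"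
    using D1 E1 order_trans[OF E1(1) mult_left_mono[OF R2 g2(1)]] by (intro add_mono) auto
  also have "\<dots> = (g1 + 1.1 * g2) * N" by (simp add: algebra_simps)
  also have "\<dots> \<le> (1.152 * (y1 + y2)) * N"
    using g1 g2 y by (intro mult_right_mono N0) auto
  also have "N \<le> m * (k * a)\<^sup>2"
    using power_mono[OF norm_matrix_le_sqrt_card[of X "k * a", OF b], of 2]
    by (simp add: N_def m_def power_mult_distrib)
  finally have "norm F \<le> 1.152 * (y1 + y2) * (m * (k * a)\<^sup>2)" 
    using y by (simp add: mult_left_mono)
  also have "\<dots> = 1.152 * t * a\<^sup>2" by (simp add: t_y power_mult_distrib)
  finally have F: "norm F \<le> 1.152 * t * a\<^sup>2" .
  define \<eta> where "\<eta> = 1.152 * t"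
  have \<eta>: "0 < \<eta>" "\<eta> < 0.2305" using t t0 by (auto simp: \<eta>_def)
  have diff: "\<bar>(norm (R *v z))\<^sup>2 - (norm (X *v z))\<^sup>2\<bar> \<le> \<eta> * (norm (X *v z))\<^sup>2" for z
  proof -
    have "(norm (R *v z))\<^sup>2 - (norm (X *v z))\<^sup>2 = z \<bullet> (F *v z)"
      by (simp only: F_def matrix_vector_mult_diff_rdistrib inner_diff_right inner_gram dot_square_norm)
    also have "\<bar>\<dots>\<bar> \<le> norm z * (norm F * norm z)"
      by (rule order_trans[OF Cauchy_Schwarz_ineq2]) (intro mult_left_mono norm_matrix_vector_le norm_ge_zero)
    also have "\<dots> = norm F * (norm z)\<^sup>2" by (simp add: power2_eq_square)
    also have "\<dots> \<le> (\<eta> * a\<^sup>2) * (norm z)\<^sup>2" using F by (intro mult_right_mono) (auto simp: \<eta>_def)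
    also have "\<dots> = \<eta> * (a * norm z)\<^sup>2" by (simp add: power_mult_distrib)
    also have "\<dots> \<le> \<eta> * (norm (X *v z))\<^sup>2"
      using \<eta> a by (intro mult_left_mono power_mono) auto
    finally show ?thesis .
  qed
  \<comment> \<open>\<open>1 - \<eta> / 2\<close> is a polynomial lower bound for the reciprocal of
    \<open>sqrt (1 + \<eta>)\<close>.\<close>
  have lo: "(1 - \<eta> / 2) * norm (R *v z) \<le> norm (X *v z)" for z
  proof (rule power2_le_imp_le)
    have "(1 - \<eta> / 2)\<^sup>2 * (norm (R *v z))\<^sup>2 \<le> (1 - \<eta> / 2)\<^sup>2 * ((1 + \<eta>) * (norm (X *v z))\<^sup>2)"
      using diff[of z] by (intro mult_left_mono) (auto simp: algebra_simps)
    also have "\<dots> = ((1 - \<eta> / 2)\<^sup>2 * (1 + \<eta>)) * (norm (X *v z))\<^sup>2" by simp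
    also have "\<dots> \<le> 1 * (norm (X *v z))\<^sup>2"
    proof (rule mult_right_mono)
      have "(1 - \<eta> / 2)\<^sup>2 * (1 + \<eta>) = 1 - \<eta>\<^sup>2 * (3 - \<eta>) / 4"
        by (simp add: power2_eq_square field_simps)
      also have "\<dots> \<le> 1" using \<eta> by simp
      finally show "(1 - \<eta> / 2)\<^sup>2 * (1 + \<eta>) \<le> 1" .
    qed simp
    finally show "((1 - \<eta> / 2) * norm (R *v z))\<^sup>2 \<le> (norm (X *v z))\<^sup>2"
      by (simp add: power_mult_distrib)
  qed simp
  \<comment> \<open>\<open>1 + 0.65 * \<eta>\<close> bounds the reciprocal of
    \<open>sqrt (1 - \<eta>)\<close> from above; the excess of 0.65 over 1/2 covers the higher-order
    terms for \<open>\<eta> < 0.2305\<close>.\<close>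
  have hi: "norm (X *v z) \<le> (1 + 0.65 * \<eta>) * norm (R *v z)" for z
  proof (rule power2_le_imp_le)
    have "1 * (norm (X *v z))\<^sup>2 \<le> ((1 + 0.65 * \<eta>)\<^sup>2 * (1 - \<eta>)) * (norm (X *v z))\<^sup>2"
    proof (rule mult_right_mono)
      have "(1 + 0.65 * \<eta>)\<^sup>2 * (1 - \<eta>) = 1 + \<eta> * (0.3 - 0.8775 * \<eta> - 0.4225 * (\<eta> * \<eta>))"
        by (simp add: power2_eq_square field_simps)
      moreover have "\<eta> * \<eta> \<le> 0.2305 * 0.2305" using \<eta> by (intro mult_mono) auto
      then have "0 \<le> 0.3 - 0.8775 * \<eta> - 0.4225 * (\<eta> * \<eta>)" using \<eta> by simp
      ultimately show "1 \<le> (1 + 0.65 * \<eta>)\<^sup>2 * (1 - \<eta>)" using \<eta> by simp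
    qed simp
    also have "\<dots> = (1 + 0.65 * \<eta>)\<^sup>2 * ((1 - \<eta>) * (norm (X *v z))\<^sup>2)" by simp
    also have "\<dots> \<le> (1 + 0.65 * \<eta>)\<^sup>2 * (norm (R *v z))\<^sup>2"
      using diff[of z] by (intro mult_left_mono) (auto simp: algebra_simps)
    finally show "(norm (X *v z))\<^sup>2 \<le> ((1 + 0.65 * \<eta>) * norm (R *v z))\<^sup>2"
      by (simp add: power_mult_distrib)
  qed (use \<eta> in simp)
  have rho: "0.87 * a * norm z \<le> norm (R *v z)" for z
  proof (rule power2_le_imp_le)
    have "(0.87 * a * norm z)\<^sup>2 = 0.7569 * (a * norm z)\<^sup>2" by (simp add: power2_eq_square)
    also have "\<dots> \<le> 0.7569 * (norm (X *v z))\<^sup>2" using a by (intro mult_left_mono power_mono) auto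
    also have "\<dots> \<le> (1 - \<eta>) * (norm (X *v z))\<^sup>2" using \<eta> by (intro mult_right_mono) auto
    also have "\<dots> \<le> (norm (R *v z))\<^sup>2" using diff[of z] by (simp add: algebra_simps)
    finally show "(0.87 * a * norm z)\<^sup>2 \<le> (norm (R *v z))\<^sup>2" .
  qed simp
  have normX: "norm X \<le> sqrt m * (k * a)"
    unfolding m_def by (rule norm_matrix_le_sqrt_card[OF b])
  have normR: "norm R \<le> 1.05 * (sqrt m * (k * a))"
  proof -
    have "(norm R)\<^sup>2 \<le> 1.1025 * N" using R2 N0 by simp
    also have "\<dots> = (1.05 * norm X)\<^sup>2" by (simp add: N_def power2_eq_square)
    finally have "(norm R)\<^sup>2 \<le> (1.05 * norm X)\<^sup>2" .
    then have "norm R \<le> 1.05 * norm X" by (rule power2_le_imp_le) simp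
    then show ?thesis using normX by simp
  qed
  \<comment> \<open>The denominator cancels the \<open>sqrt m\<close> of
    \<open>perturbed_solve_bounds\<close>. The constant exceeds
    \<open>1.0466 * 1.05 / (3 * 0.87)\<close>.\<close>
  define \<tau> where "\<tau> = 0.4212 * t / sqrt m"
  have sm: "1 \<le> sqrt m" "sqrt m * sqrt m = m" using mn by auto
  have \<tau>: "0 \<le> \<tau>" "\<tau> \<le> 0.08424"
  proof -
    show "0 \<le> \<tau>" using t0 mn by (simp add: \<tau>_def)
    have "\<tau> \<le> 0.4212 * t / 1" unfolding \<tau>_def using t0 sm by (intro divide_left_mono) auto
    then show "\<tau> \<le> 0.08424" using t by simp
  qed
  \<comment> \<open>The factor 3 is \<open>2 * 1.5\<close>: \<open>m * u\<close> lies below both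
    \<open>y1\<close> and \<open>y2\<close>, and \<open>1.5 \<le> k\<close> supplies the second
    factor \<open>k\<close>.\<close>
  have muk: "m * u * k * m \<le> t / 3"
  proof -
    have "3 * (m * u * k * m) = 2 * m * (m * u) * (1.5 * k)" by simp
    also have "\<dots> \<le> 2 * m * (m * u) * (k * k)"
      using mn u k by (intro mult_left_mono mult_right_mono) auto
    also have "\<dots> = k\<^sup>2 * m * (m * u + m * u)" by (simp add: power2_eq_square algebra_simps)
    also have "\<dots> \<le> t"
      unfolding t_y using mu mn u by (intro mult_left_mono add_mono) (auto simp: y1_def)
    finally show ?thesis by simp
  qed
  have tau: "g3 * norm R / (0.87 * a) \<le> \<tau>"
  proof -
    have at: "0 \<le> a * t / sqrt m" using a t0 sm by simp
    have "g3 * norm R \<le> (1.0466 * (m * u)) * (1.05 * (sqrt m * (k * a)))"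
      using g3 normR by (intro mult_mono) auto
    also have "\<dots> = 1.09893 * a * (m * u * k * m) / sqrt m"
      using sm by (simp add: field_simps)
    also have "\<dots> \<le> 1.09893 * a * (t / 3) / sqrt m"
      using muk a sm by (intro divide_right_mono mult_left_mono) auto
    also have "\<dots> = 0.36631 * (a * t / sqrt m)" by simp
    also have "\<dots> \<le> 0.366444 * (a * t / sqrt m)" using at by (intro mult_right_mono) auto
    also have "\<dots> = 0.87 * a * \<tau>" by (simp add: \<tau>_def)
    finally show ?thesis using a by (simp add: field_simps)
  qed
  have phi: "sqrt CARD('m) * \<tau> / (1 - \<tau>) \<le> 0.46 * t"
  proof -
    have "sqrt CARD('m) * \<tau> = 0.4212 * t" using sm by (simp add: \<tau>_def flip: m_def)
    also have "\<dots> \<le> 0.46 * t * (1 - \<tau>)"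
      using mult_left_mono[of "0.4212 / 0.46" "1 - \<tau>" "0.46 * t"] \<tau> t0 by simp
    finally show ?thesis using \<tau> by (simp add: pos_divide_le_eq)
  qed
  note B = perturbed_solve_bounds[of Q R X g3 "0.87 * a" "1 - \<eta> / 2" "1 + 0.65 * \<eta>" \<tau> "0.46 * t",
      OF _ _ rho lo hi \<tau>(1) tau _ phi]
  have pre: "norm (Q ** R - X) \<le> g3 * norm R * norm Q"
    using fl_row_solve_norm[OF G(3)] g3 by (simp add: g3_def)
  \<comment> \<open>Naming the square makes the remaining comparisons linear in \<open>t\<close> and
    \<open>q\<close>.\<close>
  define q where "q = t * t"
  have q: "0 \<le> q" "q \<le> 1 / 5 * t" unfolding q_def using t t0 by (simp, intro mult_right_mono) auto
  have "(1 - \<eta> / 2 - (1 + 0.65 * \<eta>) * (0.46 * t)) * norm x \<le> norm (Q *v x)"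
    using B(1)[OF pre] a \<tau> \<eta> by simp
  moreover have "1 - \<eta> / 2 - (1 + 0.65 * \<eta>) * (0.46 * t) = 1 - 1.036 * t - 0.344448 * q"
    by (simp add: \<eta>_def q_def field_simps)
  then have "1 - 1.11 * t \<le> 1 - \<eta> / 2 - (1 + 0.65 * \<eta>) * (0.46 * t)" using q by simp
  ultimately show "(1 - 1.11 * t) * norm x \<le> norm (Q *v x)"
    by (meson mult_right_mono norm_ge_zero order_trans)
  have "norm (Q *v x) \<le> (1 + 0.65 * \<eta>) * (1 + 0.46 * t) * norm x"
    using B(2)[OF pre] a \<tau> \<eta> by simp
  moreover have "(1 + 0.65 * \<eta>) * (1 + 0.46 * t) = 1 + 1.2088 * t + 0.344448 * q"
    by (simp add: \<eta>_def q_def field_simps)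
  then have "(1 + 0.65 * \<eta>) * (1 + 0.46 * t) \<le> 1 + 1.28 * t" using q by simp
  ultimately show "norm (Q *v x) \<le> (1 + 1.28 * t) * norm x"
    by (meson mult_right_mono norm_ge_zero order_trans)
qed

text \<open>Since the Householder factor \<open>T\<close> is an isometry,
  \<open>norm (R *v z)\<close> is the norm of the sketch of \<open>V *v z\<close> perturbed by one
  matrix \<open>F\<close> that collects the multiplication and QR errors. Hypothesis
  \<open>D\<close> makes \<open>F\<close> at most 12 percent of the lower bound \<open>a * s\<close>
  for the sketched matrix. Thus \<open>R\<close> is comparable with \<open>V\<close> up to the
  distortions \<open>s\<close> and \<open>s'\<close>, and the triangular solve is a small
  perturbation.\<close>

lemma randQR_bounds:
  fixes V Q :: "real^'m::{finite,linorder}^'n" and S :: "real^'n^'p"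
  assumes u: "0 < u" and dims: "CARD('m) \<le> CARD('p)"
    and nu: "real CARD('n) * u \<le> 1 / 24" and mu: "real CARD('m) * u \<le> 1 / 24"
    and a: "0 < a" "\<And>x. a * norm x \<le> norm (V *v x)"
    and b: "\<And>x. norm (V *v x) \<le> b * norm x"
    and s: "0 < s" "s \<le> 1" "\<And>x. s * norm (V *v x) \<le> norm (S *v (V *v x))"
    and s': "0 < s'" "s' \<le> 1.41" "\<And>x. norm (S *v (V *v x)) \<le> s' * norm (V *v x)"
    and D: "383 * (real CARD('p) * real CARD('m) * sqrt CARD('m)
                 + real CARD('n) * sqrt CARD('m) * norm S) * u * b \<le> a * s"
    and fl: "fl_randQR u S V Q R"
  shows "(0.8636 / s' - 1.1364 / s * 0.005) * norm x \<le> norm (Q *v x)"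
    "norm (Q *v x) \<le> 1.1364 / s * 1.005 * norm x"
proof -
  define m n p where "m = real CARD('m)" and "n = real CARD('n)" and "p = real CARD('p)"
  have mp: "1 \<le> m" "m \<le> p" "0 < n" using dims by (auto simp: m_def p_def n_def Suc_le_eq)
  have sm: "1 \<le> sqrt m" "sqrt m \<le> m" using mp by (auto intro!: real_le_lsqrt self_le_power)
  have ab: "a \<le> b"
    using a(2)[of "axis undefined 1"] b[of "axis undefined 1"] by simp
  then have b0: "0 < b" using a by simp
  have D': "383 * (p * m * sqrt m + n * sqrt m * norm S) * u * b \<le> a * s"
    using D by (simp add: m_def n_def p_def)
  have D1: "383 * (p * m * sqrt m * u * b) \<le> a * s"
  proof -
    have "0 \<le> n * sqrt m * norm S * u * b" using mp u b0 sm by simp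
    then show ?thesis using D' by (simp add: algebra_simps)
  qed
  \<comment> \<open>As \<open>a \<le> b\<close>, \<open>s \<le> 1\<close> and
    \<open>sqrt m \<ge> 1\<close>, hypothesis \<open>D\<close> already bounds
    \<open>p * m * u\<close>, which keeps the denominator of the Householder \<open>gam\<close> away
    from zero.\<close>
  have "383 * (p * m * u) * b \<le> 1 * b"
  proof -
    have "383 * (p * m * u) * b * 1 \<le> 383 * (p * m * u) * b * sqrt m"
      using sm mp u b0 by (intro mult_left_mono) auto
    also have "\<dots> \<le> a * s" using D1 by (simp add: mult_ac)
    also have "\<dots> \<le> b * 1" using ab a s b0 by (intro mult_mono) auto
    finally show ?thesis by simp
  qed
  then have pmu: "383 * (p * m * u) \<le> 1" using b0 by (rule mult_right_le_imp_le)
  define g1 g2 g3 where "g1 = gam u CARD('n)" and "g2 = gam u (29 * CARD('p) * CARD('m))"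
    and "g3 = gam u CARD('m)"
  have g1: "0 \<le> g1" "g1 \<le> 1.05 * (n * u)"
    using gam_bounds[of u "CARD('n)" "1 / 24"] u nu mp by (auto simp: g1_def n_def)
  have g3: "0 \<le> g3" "g3 \<le> 1.05 * (m * u)"
    using gam_bounds[of u "CARD('m)" "1 / 24"] u mu mp by (auto simp: g3_def m_def)
  have g2: "0 \<le> g2" "g2 \<le> 31.4 * (p * m * u)"
    using gam_bounds[of u "29 * CARD('p) * CARD('m)" "29 / 383"] u pmu mp
    by (auto simp: g2_def m_def p_def mult_ac)
  obtain W where W: "fl_matmul u S V W" "fl_householder_qr u W R" "fl_row_solve u V R Q"
    using fl by (auto simp: fl_randQR_def)
  obtain T :: "real^'m::{finite,linorder}^'p" and E where T: "transpose T ** T = mat 1" "W + E = T ** R"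
    and E: "\<And>j. norm (column j E) \<le> g2 * norm (column j W)"
    using W(2) by (auto simp: fl_householder_qr_def g2_def)
  have normV: "norm V \<le> sqrt m * b"
    unfolding m_def by (rule norm_matrix_le_sqrt_card[OF b])
  have SV: "norm ((S ** V) *v x) \<le> s' * b * norm x" for x
    using order_trans[OF s'(3) mult_left_mono[OF b]] s'(1)
    by (simp add: matrix_vector_mul_assoc[symmetric] mult_ac)
  have normSV: "norm (S ** V) \<le> sqrt m * (s' * b)"
    unfolding m_def by (rule norm_matrix_le_sqrt_card[OF SV])
  define e where "e = norm (W - S ** V)"
  have e: "e \<le> 1.05 * (n * sqrt m * norm S * u * b)"
  proof -
    have "e \<le> g1 * (norm S * norm V)"
      using fl_matmul_norm[OF W(1)] g1 by (simp add: e_def g1_def)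
    also have "\<dots> \<le> (1.05 * (n * u)) * (norm S * (sqrt m * b))"
      using g1 normV u mp by (intro mult_mono) auto
    finally show ?thesis by (simp add: mult_ac)
  qed
  \<comment> \<open>44.3 covers \<open>31.4 * 1.41\<close>, and 0.082 covers
    \<open>31.4 / 383\<close>.\<close>
  have normE: "norm E \<le> 44.3 * (p * m * sqrt m * u * b) + 0.082 * e"
  proof -
    have "norm W \<le> norm (S ** V) + e"
      using norm_triangle_ineq[of "S ** V" "W - S ** V"] by (simp add: e_def)
    also have "\<dots> \<le> sqrt m * (1.41 * b) + e"
      using normSV s' b0 sm by (smt (verit) mult_left_mono mult_right_mono)
    finally have W': "norm W \<le> sqrt m * (1.41 * b) + e" .
    have "norm E \<le> g2 * norm W" by (rule norm_le_columnwise[OF g2(1) E])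
    also have "\<dots> \<le> g2 * (sqrt m * (1.41 * b) + e)" by (rule mult_left_mono[OF W' g2(1)])
    also have "\<dots> = g2 * (sqrt m * (1.41 * b)) + g2 * e" by (simp add: algebra_simps)
    also have "\<dots> \<le> (31.4 * (p * m * u)) * (sqrt m * (1.41 * b)) + 0.082 * e"
      using g2 b0 sm pmu by (intro add_mono mult_right_mono) (auto simp: e_def)
    also have "\<dots> \<le> 44.3 * (p * m * sqrt m * u * b) + 0.082 * e"
      using u b0 sm mp by simp
    finally show ?thesis .
  qed
  define F where "F = (W - S ** V) + E"
  have normF: "norm F \<le> 0.12 * (a * s)"
  proof -
    have "0 \<le> n * sqrt m * norm S * u * b" using mp u b0 sm by simp
    then have "e + norm E \<le> 1.2 * (n * sqrt m * norm S * u * b) + 44.3 * (p * m * sqrt m * u * b)"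
      using e normE by simp
    moreover have "norm F \<le> e + norm E" unfolding F_def e_def by (rule norm_triangle_ineq)
    ultimately have "norm F \<le> 1.2 * (n * sqrt m * norm S * u * b) + 44.3 * (p * m * sqrt m * u * b)"
      by simp
    \<comment> \<open>45.96 is \<open>0.12 * 383\<close>; the Householder coefficient 44.3
      determines how small the 0.12 can be.\<close>
    also have "\<dots> \<le> 45.96 * (n * sqrt m * norm S * u * b) + 45.96 * (p * m * sqrt m * u * b)"
      using mp u b0 sm by (intro add_mono mult_right_mono) auto
    also have "\<dots> = 0.12 * (383 * (p * m * sqrt m + n * sqrt m * norm S) * u * b)"
      by (simp add: field_simps)
    also have "\<dots> \<le> 0.12 * (a * s)" by (intro mult_left_mono D') simp
    finally show ?thesis .
  qed
  have TR: "norm (R *v z) = norm (S *v (V *v z) + F *v z)" for z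
  proof -
    have "norm (R *v z) = norm (T *v (R *v z))" by (simp add: norm_orthonormal_columns[OF T(1)])
    also have "T *v (R *v z) = (S ** V + F) *v z"
      by (simp add: matrix_vector_mul_assoc T(2)[symmetric] F_def)
    finally show ?thesis
      by (simp add: matrix_vector_mult_add_rdistrib matrix_vector_mul_assoc)
  qed
  have Fz: "norm (F *v z) \<le> 0.12 * (a * s * norm z)" for z
    using order_trans[OF norm_matrix_vector_le mult_right_mono[OF normF]] by (simp add: mult_ac)
  have SVz: "a * s * norm z \<le> norm (S *v (V *v z))" for z
    using order_trans[OF mult_left_mono[OF a(2)] s(3)] s(1) by (simp add: mult_ac)
  have R1: "norm (S *v (V *v z)) \<le> norm (R *v z) + norm (F *v z)"
    "norm (R *v z) \<le> norm (S *v (V *v z)) + norm (F *v z)" for z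
    using norm_triangle_ineq[of "S *v (V *v z)" "F *v z"] norm_diff_ineq[of "S *v (V *v z)" "F *v z"]
    by (simp_all add: TR)
  have rho: "0.88 * (a * s) * norm z \<le> norm (R *v z)" for z
    using R1[of z] Fz[of z] SVz[of z] by simp
  \<comment> \<open>0.1364 is \<open>0.12 / 0.88\<close> rounded up: the perturbation relative to
    \<open>norm (R *v z)\<close>.\<close>
  have SVR: "norm (S *v (V *v z)) \<le> 1.1364 * norm (R *v z)"
    "0.8636 * norm (R *v z) \<le> norm (S *v (V *v z))" for z
    using R1[of z] Fz[of z] SVz[of z] rho[of z] by simp_all
  have lo: "0.8636 / s' * norm (R *v z) \<le> norm (V *v z)" for z
    using order_trans[OF SVR(2) s'(3), of z] s'(1) by (simp add: field_simps)
  have hi: "norm (V *v z) \<le> 1.1364 / s * norm (R *v z)" for z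
    using order_trans[OF s(3) SVR(1), of z] s(1) by (simp add: field_simps)
  have normR: "norm R \<le> sqrt m * (1.53 * b)"
    unfolding m_def
  proof (rule norm_matrix_le_sqrt_card)
    fix z
    have "norm (R *v z) \<le> s' * b * norm z + 0.12 * (a * s * norm z)"
      using R1(2)[of z] Fz[of z] SV[of z] by (simp add: matrix_vector_mul_assoc)
    also have "\<dots> \<le> 1.41 * b * norm z + 0.12 * (b * 1 * norm z)"
      using s' s ab b0 a by (intro add_mono mult_mono) auto
    finally show "norm (R *v z) \<le> 1.53 * b * norm z" by simp
  qed
  \<comment> \<open>The bound \<open>D1\<close> carries a factor \<open>p\<close>, so \<tau> can be
    taken inversely proportional to \<open>p\<close>; then \<open>sqrt m \<le> p\<close> removes the
    dimension from \<open>phi\<close>.\<close>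
  define \<tau> where "\<tau> = 0.0048 / p"
  have p1: "1 \<le> p" using mp by simp
  have \<tau>: "0 \<le> \<tau>" "\<tau> \<le> 0.0048" using p1 by (auto simp: \<tau>_def divide_le_eq)
  have tau: "g3 * norm R / (0.88 * (a * s)) \<le> \<tau>"
  proof -
    have "p * (g3 * norm R) \<le> p * ((1.05 * (m * u)) * (sqrt m * (1.53 * b)))"
      using g3 normR p1 by (intro mult_left_mono mult_mono) auto
    also have "\<dots> = 1.6065 * (p * m * sqrt m * u * b)" by simp
    also have "\<dots> = 1.6065 / 383 * (383 * (p * m * sqrt m * u * b))" by simp
    also have "\<dots> \<le> 1.6065 / 383 * (a * s)" by (intro mult_left_mono D1) simp
    also have "\<dots> \<le> 0.88 * (a * s) * 0.0048"
      using mult_pos_pos[OF a(1) s(1)] by simp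
    finally show ?thesis using a s p1 by (simp add: \<tau>_def field_simps)
  qed
  have phi: "sqrt CARD('m) * \<tau> / (1 - \<tau>) \<le> 0.005"
  proof -
    have "sqrt m * \<tau> \<le> p * \<tau>" using sm mp \<tau> by (intro mult_right_mono) auto
    then have "sqrt m * \<tau> \<le> 0.0048" using p1 by (simp add: \<tau>_def)
    then have "sqrt m * \<tau> \<le> 0.005 * (1 - \<tau>)" using \<tau> by simp
    then show ?thesis using \<tau> by (simp add: pos_divide_le_eq m_def)
  qed
  have pre: "norm (Q ** R - V) \<le> g3 * norm R * norm Q"
    using fl_row_solve_norm[OF W(3)] g3 by (simp add: g3_def)
  note B = perturbed_solve_bounds[OF pre _ rho lo hi \<tau>(1) tau _ phi]
  show "(0.8636 / s' - 1.1364 / s * 0.005) * norm x \<le> norm (Q *v x)"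
    using B(1) a s \<tau> by simp
  show "norm (Q *v x) \<le> 1.1364 / s * 1.005 * norm x"
    using B(2) a s \<tau> by simp
qed


section \<open>Composition of the two stages on the embedding event\<close>

lemma subspace_embedding_norm_bounds:
  assumes "subspace_embedding \<epsilon> S U" "x \<in> U" "0 \<le> \<epsilon>" "\<epsilon> < 1"
  shows "sqrt (1 - \<epsilon>) * norm x \<le> norm (S *v x)" "norm (S *v x) \<le> sqrt (1 + \<epsilon>) * norm x"
proof -
  have *: "\<bar>(norm x)\<^sup>2 - (norm (S *v x))\<^sup>2\<bar> \<le> \<epsilon> * (norm x)\<^sup>2"
    using assms unfolding subspace_embedding_def
    by (metis dot_square_norm mult.assoc power2_eq_square)
  show "sqrt (1 - \<epsilon>) * norm x \<le> norm (S *v x)"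
    by (rule power2_le_imp_le) (use * assms in \<open>auto simp: power_mult_distrib algebra_simps\<close>)
  show "norm (S *v x) \<le> sqrt (1 + \<epsilon>) * norm x"
    by (rule power2_le_imp_le) (use * assms in \<open>auto simp: power_mult_distrib algebra_simps\<close>)
qed

text \<open>At \<open>\<epsilon> = 616 / 634\<close> the quotient is \<open>18 / 1250\<close>, the
  square of \<open>3 / 25\<close>. The threshold is thus exactly where the denominator
  \<open>25 * sqrt ((1 - \<epsilon>) / (1 + \<epsilon>)) - 3\<close> vanishes.\<close>

lemma embedding_ratio_gt:
  assumes "0 \<le> \<epsilon>" "\<epsilon> < 616 / 634"
  shows "3 / 25 < sqrt ((1 - \<epsilon>) / (1 + \<epsilon>))"
  using assms by (intro real_less_rsqrt) (simp add: power2_eq_square field_simps)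

text \<open>The deterministic part, for one drawn \<open>S\<close>. The first stage yields bounds
  \<open>a0\<close> and \<open>b0\<close> for \<open>Q0\<close> with \<open>b0 \<le> k * a0\<close>,
  which is the input that \<open>cholQR_bounds\<close> requires.\<close>

lemma rand_cholQR_cond_num_le:
  fixes V Q :: "real^'m::{finite,linorder}^'n" and S :: "real^'n^'p"
  assumes \<epsilon>: "0 \<le> \<epsilon>" "\<epsilon> < 616 / 634"
    and emb: "subspace_embedding \<epsilon> S (range ((*v) V))"
    and rank: "rank V = CARD('m)"
    and dims: "1 < CARD('m)" "CARD('m) \<le> CARD('p)" "CARD('p) \<le> CARD('n)"
    and u: "0 < u" "real CARD('n) * real CARD('m) * u \<le> 1 / 12"
    and t_def: "t = (33 / (25 * sqrt ((1 - \<epsilon>) / (1 + \<epsilon>)) - 3))\<^sup>2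
                  * (real CARD('n) * real CARD('m) + real CARD('m) * (real CARD('m) + 1)) * u"
    and t: "t < 1 / 5"
    and delta: "delta u \<epsilon> S V \<le> 1"
    and fl: "fl_rand_cholQR u S V Q R"
  shows "cond_num Q \<le> ereal ((1 + 1.28 * t) / (1 - 1.11 * t))"
proof -
  define m n p where "m = real CARD('m)" and "n = real CARD('n)" and "p = real CARD('p)"
  have mnp: "2 \<le> m" "m \<le> p" "p \<le> n" using dims by (auto simp: m_def n_def p_def)
  have "2 * (n * u) \<le> m * (n * u)" using mnp u by (intro mult_right_mono) auto
  then have nu: "n * u \<le> 1 / 24" using u(2) by (simp add: m_def n_def mult_ac)
  have "m * u \<le> n * u" using mnp u by (intro mult_right_mono) auto
  then have mu: "m * u \<le> 1 / 24" using nu by simp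
  define s s' r where "s = sqrt (1 - \<epsilon>)" and "s' = sqrt (1 + \<epsilon>)"
    and "r = sqrt ((1 - \<epsilon>) / (1 + \<epsilon>))"
  have s: "0 < s" "s \<le> 1" using \<epsilon> by (auto simp: s_def)
  \<comment> \<open>The bound on \<epsilon> gives \<open>1 + \<epsilon> < 1250 / 634\<close>, which
    is below the square of 1.41.\<close>
  have s': "0 < s'" "s' \<le> 1.41"
    unfolding s'_def using \<epsilon> by (simp, intro real_le_lsqrt) (auto simp: power2_eq_square)
  have r_s: "r = s / s'" by (simp add: r_def s_def s'_def real_sqrt_divide)
  have r: "0.12 < r" "r \<le> 1"
    using embedding_ratio_gt[OF \<epsilon>] \<epsilon> by (auto simp: r_def)
  define a b where "a = sigma_min V" and "b = sigma_max V"
  have "V *v x = 0 \<Longrightarrow> x = 0" for x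
    using rank full_rank_injective[of V] injD[of "(*v) V" x 0] by auto
  then have a: "0 < a" unfolding a_def by (rule sigma_min_pos)
  define c0 where "c0 = 383 * (p * m * sqrt m + n * sqrt m * norm S)"
  have D: "c0 * u * b \<le> a * s"
  proof -
    define c1 where
      "c1 = 383 * (p * m powr (3/2) + sqrt m * (p powr (3/2) * s' + n * norm S))"
    have "ereal (c1 / s * u) * cond_num V \<le> 1"
      using delta
      by (simp add: delta_def Let_def c1_def n_def m_def p_def s_def s'_def frobenius_norm_eq_norm)
    \<comment> \<open>Full rank makes the smallest singular value positive, so the extended-real
      inequality becomes a real one.\<close>
    then have "c1 / s * u * (b / a) \<le> 1"
      using a by (simp add: cond_num_def a_def b_def one_ereal_def)
    then have 1: "c1 * u * b \<le> a * s" using a s by (simp add: field_simps)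
    have "m powr (3/2) = m * sqrt m"
      using mnp powr_add[of m 1 "1/2"] by (simp add: powr_half_sqrt)
    then have "c0 \<le> c1"
      using mnp s' by (simp add: c0_def c1_def algebra_simps)
    moreover have "0 \<le> b" using sigma_max_in[of V] by (simp add: b_def singular_values_def)
    ultimately have "c0 * u * b \<le> c1 * u * b" using u by (intro mult_right_mono) auto
    then show ?thesis using 1 by simp
  qed
  obtain Q0 R0 R1 where Q0: "fl_randQR u S V Q0 R0" and Q: "fl_cholQR u Q0 Q R1"
    using fl by (auto simp: fl_rand_cholQR_def)
  define a0 b0 where "a0 = 0.8636 / s' - 1.1364 / s * 0.005" and "b0 = 1.1364 / s * 1.005"
  have bounds0: "a0 * norm x \<le> norm (Q0 *v x)" "norm (Q0 *v x) \<le> b0 * norm x" for x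
    using randQR_bounds[of u a V b s S s' Q0 R0 x] u dims nu mu a s s' D Q0
      subspace_embedding_norm_bounds[OF emb rangeI] \<epsilon>
      sigma_max_upper[of V] sigma_min_lower[of V]
    by (simp_all add: a_def b_def s_def s'_def m_def n_def p_def c0_def a0_def b0_def)
  define k where "k = 33 / (25 * r - 3)"
  \<comment> \<open>After scaling by \<open>s\<close> both bounds depend on \<epsilon> only through
    \<open>r = s / s'\<close>. The value \<open>k = 3 / 2\<close> is reached at
    \<open>r = 1\<close>.\<close>
  have sa0: "s * a0 = 0.8636 * r - 0.005682" and sb0: "s * b0 = 1.142082"
    using s by (simp_all add: a0_def b0_def r_s field_simps)
  have "0 < s * a0" unfolding sa0 using r by simp
  then have a0: "0 < a0" using s by (simp add: zero_less_mult_iff)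
  have k: "3 / 2 \<le> k" using r by (simp add: k_def field_simps)
  have "s * b0 \<le> s * (k * a0)"
  proof -
    have "s * b0 \<le> k * (s * a0)" unfolding sa0 sb0 k_def using r by (simp add: field_simps)
    then show ?thesis by (simp add: mult_ac)
  qed
  then have b0: "b0 \<le> k * a0" using s by simp
  have t0: "0 < t"
    unfolding t_def using u k mnp
    by (intro mult_pos_pos add_pos_pos) (auto simp: k_def r_def m_def n_def)
  show ?thesis
  proof (rule cond_num_le)
    show "0 < 1 - 1.11 * t" using t by simp
    have ub: "norm (Q0 *v x) \<le> k * a0 * norm x" for x
      using bounds0(2)[of x] mult_right_mono[OF b0 norm_ge_zero[of x]] by simp
    have "CARD('m) \<le> CARD('n)" using dims by simp
    note * = cholQR_bounds[OF u(1) dims(1) this a0 bounds0(1) ub k _ t Q,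
        unfolded k_def r_def, OF t_def]
    show "(1 - 1.11 * t) * norm x \<le> norm (Q *v x)" "norm (Q *v x) \<le> (1 + 1.28 * t) * norm x" for x
      by (fact *)+
  qed
qed

text \<open>The guard \<open>c < 1\<close> makes the radicand a positive real. The condition on
  \<open>delta\<close> stands inside the random predicate because it depends on the drawn
  \<open>S\<close>.\<close>

theorem corollary5p4:
  fixes M :: "'w measure"
    and S :: "'w \<Rightarrow> real^'n^'p"
    and V :: "real^'m::{finite,linorder}^'n"
    and \<epsilon> d u c :: real
    and n m p :: nat
  assumes "prob_space M"
    and n_def: "n = CARD('n)" and m_def: "m = CARD('m)" and p_def: "p = CARD('p)"
    and "0 \<le> \<epsilon>" "\<epsilon> < 616 / 634"
    and "oblivious_embedding M S \<epsilon> d m"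
    and "rank V = m"
    and "1 < m" "m \<le> p" "p \<le> n"
    and "0 < u"
    and "real n * real m * u \<le> 1 / 12"
    and "real p powr (3/2) * u \<le> 1 / 12"
    and c_def: "c = 5445 / (25 * sqrt ((1 - \<epsilon>) / (1 + \<epsilon>)) - 3)\<^sup>2
                      * (real n * real m + real m * (real m + 1)) * u"
  shows "(c < 1 \<longrightarrow>
            holds_with_prob M (1 - d)
              (\<lambda>\<omega>. \<forall>Q R. delta u \<epsilon> (S \<omega>) V \<le> 1 \<and> fl_rand_cholQR u (S \<omega>) V Q R \<longrightarrow>
                      cond_num Q < ereal (sqrt ((1 + c) / (1 - c)))))
       \<and> (c < 1 / 2 \<longrightarrow>
            holds_with_prob M (1 - d)
              (\<lambda>\<omega>. \<forall>Q R. delta u \<epsilon> (S \<omega>) V \<le> 1 \<and> fl_rand_cholQR u (S \<omega>) V Q R \<longrightarrow>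
                      cond_num Q < ereal (1 + 2 * c)))"
proof -
  \<comment> \<open>A single event serves both claims and all admissible rounding errors: once
    \<open>S\<close> embeds the range of \<open>V\<close>, the rest is deterministic.\<close>
  define good where "good = {\<omega> \<in> space M. subspace_embedding \<epsilon> (S \<omega>) (range ((*v) V))}"
  have "subspace (range ((*v) V))" "dim (range ((*v) V)) = m"
    using \<open>rank V = m\<close>
    by (auto simp: rank_dim_range intro!: linear_subspace_image matrix_vector_mul_linear)
  then have good: "1 - d \<le> measure M good"
    using \<open>oblivious_embedding M S \<epsilon> d m\<close> by (auto simp: oblivious_embedding_def good_def)
  have prob: "holds_with_prob M (1 - d) P" if P: "\<And>\<omega>. \<omega> \<in> good \<Longrightarrow> P \<omega>" for P
  proof (cases "good \<in> sets M")
    case True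
    then show ?thesis using good P by (auto simp: holds_with_prob_def)
  next
    case False \<comment> \<open>a non-measurable set has \<open>measure\<close> zero, so that \<open>1 - d \<le> 0\<close>\<close>
    then show ?thesis
      using good by (auto simp: holds_with_prob_def measure_notin_sets intro!: bexI[of _ "{}"])
  qed
  \<comment> \<open>\<open>5445 = 5 * 33\<^sup>2\<close>, so \<open>t\<close> carries the square of
    the bound \<open>k\<close> on the condition number of \<open>Q0\<close>.\<close>
  define t where "t = c / 5"
  have c: "c = 5 * t" by (simp add: t_def)
  have t_eq: "t = (33 / (25 * sqrt ((1 - \<epsilon>) / (1 + \<epsilon>)) - 3))\<^sup>2
      * (real CARD('n) * real CARD('m) + real CARD('m) * (real CARD('m) + 1)) * u"
  proof -
    have "5445 / q * x * u / 5 = 33\<^sup>2 / q * x * u" for q x :: real by simp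
    then show ?thesis unfolding t_def c_def n_def m_def power_divide .
  qed
  have cond: "cond_num Q \<le> ereal ((1 + 1.28 * t) / (1 - 1.11 * t))"
    if "\<omega> \<in> good" "delta u \<epsilon> (S \<omega>) V \<le> 1" "fl_rand_cholQR u (S \<omega>) V Q R" "c < 1" for \<omega> Q R
    by (rule rand_cholQR_cond_num_le[OF _ _ _ _ _ _ _ _ _ t_eq])
      (use that assms in \<open>auto simp: good_def c\<close>)
  then have t0: "0 < t"
    unfolding t_eq using \<open>0 < u\<close> embedding_ratio_gt[OF \<open>0 \<le> \<epsilon>\<close> \<open>\<epsilon> < 616 / 634\<close>]
    by (intro mult_pos_pos add_pos_pos) auto
  show ?thesis
  proof (intro conjI impI prob allI; elim conjE)
    fix \<omega> Q R
    assume *: "c < 1" "\<omega> \<in> good" "delta u \<epsilon> (S \<omega>) V \<le> 1" "fl_rand_cholQR u (S \<omega>) V Q R"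
    have t: "t < 1 / 5" using * by (simp add: c)
    have "((1 + 1.28 * t) / (1 - 1.11 * t))\<^sup>2 < (1 + c) / (1 - c)"
      unfolding power_divide c
    proof (rule frac_less)
      define q where "q = t * t"
      have "q \<le> 1 / 5 * t" unfolding q_def using t t0 by (intro mult_right_mono) auto
      moreover have "(1 + 1.28 * t)\<^sup>2 = 1 + 2.56 * t + 1.6384 * q"
        by (simp add: q_def power2_eq_square field_simps)
      ultimately show "(1 + 1.28 * t)\<^sup>2 < 1 + 5 * t" using t0 by simp
      show "1 - 5 * t \<le> (1 - 1.11 * t)\<^sup>2"
        using t0 by (simp add: power2_eq_square algebra_simps)
    qed (use t t0 in auto)
    then have "(1 + 1.28 * t) / (1 - 1.11 * t) < sqrt ((1 + c) / (1 - c))"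
      by (rule real_less_rsqrt)
    then show "cond_num Q < ereal (sqrt ((1 + c) / (1 - c)))"
      using cond[of \<omega> Q R] * by (simp add: order_le_less_trans)
  next
    fix \<omega> Q R
    assume *: "c < 1 / 2" "\<omega> \<in> good" "delta u \<epsilon> (S \<omega>) V \<le> 1" "fl_rand_cholQR u (S \<omega>) V Q R"
    have t: "t < 1 / 10" using * by (simp add: c)
    define q where "q = t * t"
    have "q \<le> 1 / 10 * t" unfolding q_def using t t0 by (intro mult_right_mono) auto
    \<comment> \<open>The right-hand side is \<open>(1 + 10 * t) * (1 - 1.11 * t)\<close> expanded;
      \<open>q \<le> t / 10\<close> leaves a linear coefficient of at least 7.78.\<close>
    then have "1 + 1.28 * t < 1 + 8.89 * t - 11.1 * q" using t0 by simp
    also have "\<dots> = (1 + 2 * c) * (1 - 1.11 * t)" by (simp add: c q_def field_simps)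
    finally have "(1 + 1.28 * t) / (1 - 1.11 * t) < 1 + 2 * c"
      using t by (simp add: pos_divide_less_eq)
    then show "cond_num Q < ereal (1 + 2 * c)"
      using cond[of \<omega> Q R] * by (simp add: order_le_less_trans)
  qed
qed


end
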